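(* Assume that the artificial data-points $(X_j)_{j\ge1}$ are IID (with distribution $\mathbb{P}_\psi$), and that: (H4) the maps $\theta\mapsto h_\theta(x)$ are twice continuously differentiable in a neighbourhood of $\theta^\star$ for $\mathbb{P}_\psi$-almost every $x$; the Fisher information $\mathbf{I}(\theta)=\mathbb{V}_\theta(\nabla_\theta\log h_\theta(Y))$ is invertible at $\theta=\theta^\star$; and for some $\varepsilon>0$, $\int_{\mathcal{X}}c_\varepsilon(x)\sup_{\theta\in B(\theta^\star,\varepsilon)}h_\theta(x)\,\mu(\mathrm{d}x)<\infty$, where $c_\varepsilon(x)=1+\sup_{\theta\in B(\theta^\star,\varepsilon)}\|\nabla_\theta\log h_\theta(x)\|^2+\sup_{\theta\in B(\theta^\star,\varepsilon)}\|\nabla_\theta^2\log h_\theta(x)\|$; (I3) at $\theta=\theta^\star$, $\mathbb{E}_\psi\big[d_\theta(X)\big(\frac{h_\theta(X)}{h_\psi(X)}\big)^2\big]<\infty$, where $d_\theta(x)=1+\|\nabla_\theta\log h_\theta(x)\|^2$. Then $\mathbf{V}^{\mathrm{IS}}_\tau(\xi^\star)\succcurlyeq\mathbf{V}^{\mathrm{NCE}}_\tau(\xi^\star)$, i.e. $\mathbf{V}^{\mathrm{IS}}_\tau(\xi^\star)-\mathbf{V}^{\mathrm{NCE}}_\tau(\xi^\star)$ is a positive semi-definite matrix.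
   Context: Setting. $\Theta$ is an open subset of $\mathbb{R}^d$, $\mathcal{X}\subset\mathbb{R}^k$, $\mu$ is a measure on $\mathcal{X}$, and for each $\theta\in\Theta$, $h_\theta\ge0$ is a measurable function on $\mathcal{X}$ with $\mathcal{Z}(\theta)=\int_{\mathcal{X}}h_\theta(x)\,\mu(\mathrm{d}x)\in(0,\infty)$. $\mathbb{P}_\theta$ is the probability with density $f_\theta=h_\theta/\mathcal{Z}(\theta)$ with respect to $\mu$; the model is identifiable. $\mathbb{P}_\psi$ is a probability with density $f_\psi=h_\psi/\mathcal{Z}(\psi)$ with respect to $\mu$ (where $h_\psi\geq 0$ and $\mathcal{Z}(\psi)=\int h_\psi\,\mathrm{d}\mu\in(0,\infty)$); it need not belong to the model, but $\mathbb{P}_\theta\ll\mathbb{P}_\psi$ for every $\theta\in\Theta$. $\mathbb{E}_\theta,\mathbb{V}_\theta$ (resp. $\mathbb{E}_\psi,\mathbb{V}_\psi$) denote expectation and covariance matrix under $Y\sim\mathbb{P}_\theta$ (resp. $X\sim\mathbb{P}_\psi$). $\theta^\star\in\Theta$ is the true parameter, $\xi^\star=(\theta^\star,\nu^\star)$ with $\nu^\star=\log\{\mathcal{Z}(\psi)/\mathcal{Z}(\theta^\star)\}$, and $\tau\in(0,+\infty)$. For $\xi=(\theta,\nu)\in\Theta\times\mathbb{R}$ let $g_\xi(x)=\log h_\theta(x)+\nu$, so $\nabla_\xi g_\xi=(\nabla_\theta\log h_\theta^T,1)^T$, and let $\nabla_\xi\nabla_\xi^Tg_\xi$ denote $\nabla_\xi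 g_\xi(\nabla_\xi g_\xi)^T$. The asymptotic variances of the NCE and MC-MLE estimators are $$\mathbf{V}^{\mathrm{NCE}}_\tau(\xi)=\mathbf{J}_\tau(\xi)^{-1}\{\boldsymbol\Sigma_\tau(\xi)+\tau^{-1}\boldsymbol\Gamma_\tau(\xi)\}\mathbf{J}_\tau(\xi)^{-1},\qquad \mathbf{V}^{\mathrm{IS}}_\tau(\xi)=\mathbf{J}(\xi)^{-1}\{\boldsymbol\Sigma(\xi)+\tau^{-1}\boldsymbol\Gamma(\xi)\}\mathbf{J}(\xi)^{-1},$$ where, with $R=\tau f_\psi/(\tau f_\psi+f_\theta)$, $$\mathbf{J}_\tau(\xi)=\mathbb{E}_\theta[(\nabla_\xi\nabla_\xi^Tg_\xi\,R)(Y)],\quad \boldsymbol\Sigma_\tau(\xi)=\mathbb{V}_\theta((\nabla_\xi g_\xi\,R)(Y)),\quad \mathbf{J}(\xi)=\mathbb{E}_\theta[\nabla_\xi\nabla_\xi^Tg_\xi(Y)],\quad \boldsymbol\Sigma(\xi)=\mathbb{V}_\theta(\nabla_\xi g_\xi(Y)),$$ and, in the present case of IID artificial data-points (for which the autocovariance terms in the general Markov chain definition of $\boldsymbol\Gamma_\tau,\boldsymbol\Gamma$ vanish), $$\boldsymbol\Gamma_\tau(\xi)=\mathbb{V}_\psi\Big(\Big(\nabla_\xi g_\xi\frac{f_\theta}{f_\psi}R\Big)(X)\Big),\qquad \boldsymbol\Gamma(\xi)=\mathbb{V}_\psi\Big(\Big(\nabla_\xi g_\xi\frac{f_\theta}{f_\psi}\Big)(X)\Big).$$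 *)

theory Defs
  imports "HOL-Probability.Probability"
begin

text \<open>Only meaningful at points where \<open>f\<close> is differentiable.\<close>

definition grad :: "('a::real_inner \<Rightarrow> real) \<Rightarrow> 'a \<Rightarrow> 'a" where
  "grad f x = (THE D. GDERIV f x :> D)"

definition hessian :: "(real^'n \<Rightarrow> real) \<Rightarrow> real^'n \<Rightarrow> real^'n^'n" where
  "hessian f x = jacobian (grad f) (at x)"

definition twice_cont_diff_on :: "(real^'n \<Rightarrow> real) \<Rightarrow> (real^'n) set \<Rightarrow> bool" where
  "twice_cont_diff_on f U \<longleftrightarrow>
     (\<exists>(G :: real^'n \<Rightarrow> real^'n) (H :: real^'n \<Rightarrow> real^'n^'n).
        (\<forall>x\<in>U. GDERIV f x :> G x) \<and>
        (\<forall>x\<in>U. (G has_derivative (\<lambda>v. H x *v v)) (at x)) \<and>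
        continuous_on U H)"

definition outer :: "real^'n \<Rightarrow> real^'n \<Rightarrow> real^'n^'n" where
  "outer v w = (\<chi> i j. v $ i * w $ j)"

definition psd :: "real^'n^'n \<Rightarrow> bool" where
  "psd A \<longleftrightarrow> transpose A = A \<and> (\<forall>v. 0 \<le> v \<bullet> (A *v v))"

definition loewner_le :: "real^'n^'n \<Rightarrow> real^'n^'n \<Rightarrow> bool" where
  "loewner_le A B \<longleftrightarrow> psd (B - A)"

text \<open>
  The integrands below involve gradients that exist only almost everywhere, so they are in
  general measurable only with respect to the completion of the underlying probability.
  On functions measurable for \<open>P\<close> itself, \<open>expct P\<close> is the usual integral
  (\<open>integral_completion\<close>).
\<close>

definition expct :: "'x measure \<Rightarrow> ('x \<Rightarrow> 'b) \<Rightarrow> 'b::{banach, second_countable_topology}" where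
  "expct P \<phi> = (\<integral>x. \<phi> x \<partial>completion P)"

definition covar :: "'x measure \<Rightarrow> ('x \<Rightarrow> real^'n) \<Rightarrow> real^'n^'n" where
  "covar P \<phi> = expct P (\<lambda>x. outer (\<phi> x - expct P \<phi>) (\<phi> x - expct P \<phi>))"

definition normalizer :: "'x measure \<Rightarrow> ('x \<Rightarrow> real) \<Rightarrow> real" where
  "normalizer \<mu> h = (\<integral>x. h x \<partial>\<mu>)"

definition norm_density :: "'x measure \<Rightarrow> ('x \<Rightarrow> real) \<Rightarrow> 'x \<Rightarrow> real" where
  "norm_density \<mu> h x = h x / normalizer \<mu> h"

definition prob_of :: "'x measure \<Rightarrow> ('x \<Rightarrow> real) \<Rightarrow> 'x measure" where
  "prob_of \<mu> h = density \<mu> (\<lambda>x. ennreal (norm_density \<mu> h x))"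

text \<open>The integrability conjunct together with positivity says that the normalising
  constant lies in \<open>(0,\<infinity>)\<close>.\<close>

definition unnormalized_density :: "'x measure \<Rightarrow> ('x \<Rightarrow> real) \<Rightarrow> bool" where
  "unnormalized_density \<mu> h \<longleftrightarrow>
     h \<in> borel_measurable \<mu> \<and> (\<forall>x\<in>space \<mu>. 0 \<le> h x) \<and>
     integrable \<mu> h \<and> 0 < normalizer \<mu> h"

definition grad_log :: "(real^'d \<Rightarrow> 'x \<Rightarrow> real) \<Rightarrow> real^'d \<Rightarrow> 'x \<Rightarrow> real^'d" where
  "grad_log h \<theta> x = grad (\<lambda>t. ln (h t x)) \<theta>"

definition hess_log :: "(real^'d \<Rightarrow> 'x \<Rightarrow> real) \<Rightarrow> real^'d \<Rightarrow> 'x \<Rightarrow> real^'d^'d" where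
  "hess_log h \<theta> x = hessian (\<lambda>t. ln (h t x)) \<theta>"

definition fisher_info :: "'x measure \<Rightarrow> (real^'d \<Rightarrow> 'x \<Rightarrow> real) \<Rightarrow> real^'d \<Rightarrow> real^'d^'d" where
  "fisher_info \<mu> h \<theta> = covar (prob_of \<mu> (h \<theta>)) (grad_log h \<theta>)"

definition ext_model :: "(real^'d \<Rightarrow> 'x \<Rightarrow> real) \<Rightarrow> (real^'d) \<times> real \<Rightarrow> 'x \<Rightarrow> real" where
  "ext_model h \<xi> x = ln (h (fst \<xi>) x) + snd \<xi>"

text \<open>The extended parameter lives in \<open>(real^'d) \<times> real\<close>; its gradient is written as a vector
  indexed by \<open>'d + 1\<close> (the \<open>\<theta>\<close>-coordinates, then the \<open>\<nu>\<close>-coordinate), so that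
  library matrices can be used.\<close>

definition flatten :: "(real^'d) \<times> real \<Rightarrow> real^('d + 1)" where
  "flatten p = (\<chi> i. case i of Inl j \<Rightarrow> fst p $ j | Inr _ \<Rightarrow> snd p)"

definition grad_ext :: "(real^'d \<Rightarrow> 'x \<Rightarrow> real) \<Rightarrow> (real^'d) \<times> real \<Rightarrow> 'x \<Rightarrow> real^('d + 1)" where
  "grad_ext h \<xi> x = flatten (grad (\<lambda>\<zeta>. ext_model h \<zeta> x) \<xi>)"

definition nce_ratio ::
  "'x measure \<Rightarrow> (real^'d \<Rightarrow> 'x \<Rightarrow> real) \<Rightarrow> ('x \<Rightarrow> real) \<Rightarrow> real \<Rightarrow> (real^'d) \<times> real \<Rightarrow> 'x \<Rightarrow> real" where
  "nce_ratio \<mu> h h\<psi> \<tau> \<xi> x =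
     \<tau> * norm_density \<mu> h\<psi> x /
     (\<tau> * norm_density \<mu> h\<psi> x + norm_density \<mu> (h (fst \<xi>)) x)"

definition lik_ratio ::
  "'x measure \<Rightarrow> (real^'d \<Rightarrow> 'x \<Rightarrow> real) \<Rightarrow> ('x \<Rightarrow> real) \<Rightarrow> (real^'d) \<times> real \<Rightarrow> 'x \<Rightarrow> real" where
  "lik_ratio \<mu> h h\<psi> \<xi> x = norm_density \<mu> (h (fst \<xi>)) x / norm_density \<mu> h\<psi> x"

definition J_NCE where
  "J_NCE \<mu> h h\<psi> \<tau> \<xi> = expct (prob_of \<mu> (h (fst \<xi>)))
     (\<lambda>x. nce_ratio \<mu> h h\<psi> \<tau> \<xi> x *\<^sub>R outer (grad_ext h \<xi> x) (grad_ext h \<xi> x))"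

definition Sigma_NCE where
  "Sigma_NCE \<mu> h h\<psi> \<tau> \<xi> = covar (prob_of \<mu> (h (fst \<xi>)))
     (\<lambda>x. nce_ratio \<mu> h h\<psi> \<tau> \<xi> x *\<^sub>R grad_ext h \<xi> x)"

text \<open>For IID artificial data the autocovariances of the chain vanish, so that only the
  variance under the artificial distribution remains (also in \<open>Gamma_IS\<close>).\<close>

definition Gamma_NCE where
  "Gamma_NCE \<mu> h h\<psi> \<tau> \<xi> = covar (prob_of \<mu> h\<psi>)
     (\<lambda>x. (lik_ratio \<mu> h h\<psi> \<xi> x * nce_ratio \<mu> h h\<psi> \<tau> \<xi> x) *\<^sub>R grad_ext h \<xi> x)"

definition J_IS where
  "J_IS \<mu> h \<xi> = expct (prob_of \<mu> (h (fst \<xi>)))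
     (\<lambda>x. outer (grad_ext h \<xi> x) (grad_ext h \<xi> x))"

definition Sigma_IS where
  "Sigma_IS \<mu> h \<xi> = covar (prob_of \<mu> (h (fst \<xi>))) (grad_ext h \<xi>)"

definition Gamma_IS where
  "Gamma_IS \<mu> h h\<psi> \<xi> = covar (prob_of \<mu> h\<psi>)
     (\<lambda>x. lik_ratio \<mu> h h\<psi> \<xi> x *\<^sub>R grad_ext h \<xi> x)"

definition V_NCE ::
  "'x measure \<Rightarrow> (real^'d \<Rightarrow> 'x \<Rightarrow> real) \<Rightarrow> ('x \<Rightarrow> real) \<Rightarrow> real \<Rightarrow> (real^'d) \<times> real
     \<Rightarrow> real^('d + 1)^('d + 1)" where
  "V_NCE \<mu> h h\<psi> \<tau> \<xi> =
     matrix_inv (J_NCE \<mu> h h\<psi> \<tau> \<xi>)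
     ** (Sigma_NCE \<mu> h h\<psi> \<tau> \<xi> + (1 / \<tau>) *\<^sub>R Gamma_NCE \<mu> h h\<psi> \<tau> \<xi>)
     ** matrix_inv (J_NCE \<mu> h h\<psi> \<tau> \<xi>)"

definition V_IS ::
  "'x measure \<Rightarrow> (real^'d \<Rightarrow> 'x \<Rightarrow> real) \<Rightarrow> ('x \<Rightarrow> real) \<Rightarrow> real \<Rightarrow> (real^'d) \<times> real
     \<Rightarrow> real^('d + 1)^('d + 1)" where
  "V_IS \<mu> h h\<psi> \<tau> \<xi> =
     matrix_inv (J_IS \<mu> h \<xi>)
     ** (Sigma_IS \<mu> h \<xi> + (1 / \<tau>) *\<^sub>R Gamma_IS \<mu> h h\<psi> \<xi>)
     ** matrix_inv (J_IS \<mu> h \<xi>)"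

definition c_bound :: "(real^'d \<Rightarrow> 'x \<Rightarrow> real) \<Rightarrow> real^'d \<Rightarrow> real \<Rightarrow> 'x \<Rightarrow> ennreal" where
  "c_bound h \<theta>s \<epsilon> x =
     1 + (SUP \<theta>\<in>ball \<theta>s \<epsilon>. ennreal ((norm (grad_log h \<theta> x))\<^sup>2))
       + (SUP \<theta>\<in>ball \<theta>s \<epsilon>. ennreal (norm (hess_log h \<theta> x)))"

text \<open>The ball is kept inside \<open>\<Theta>\<close> because \<open>h\<close> carries no meaning outside \<open>\<Theta>\<close>.\<close>

definition H4 ::
  "(real^'d) set \<Rightarrow> 'x measure \<Rightarrow> (real^'d \<Rightarrow> 'x \<Rightarrow> real) \<Rightarrow> ('x \<Rightarrow> real) \<Rightarrow> real^'d \<Rightarrow> bool" where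
  "H4 \<Theta> \<mu> h h\<psi> \<theta>s \<longleftrightarrow>
     (AE x in prob_of \<mu> h\<psi>. \<exists>U. open U \<and> \<theta>s \<in> U \<and> U \<subseteq> \<Theta> \<and>
        twice_cont_diff_on (\<lambda>\<theta>. h \<theta> x) U) \<and>
     invertible (fisher_info \<mu> h \<theta>s) \<and>
     (\<exists>\<epsilon>>0. ball \<theta>s \<epsilon> \<subseteq> \<Theta> \<and>
        (\<integral>\<^sup>+x. c_bound h \<theta>s \<epsilon> x * (SUP \<theta>\<in>ball \<theta>s \<epsilon>. ennreal (h \<theta> x)) \<partial>\<mu>) < \<infinity>)"

definition I3 ::
  "'x measure \<Rightarrow> (real^'d \<Rightarrow> 'x \<Rightarrow> real) \<Rightarrow> ('x \<Rightarrow> real) \<Rightarrow> real^'d \<Rightarrow> bool" where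
  "I3 \<mu> h h\<psi> \<theta> \<longleftrightarrow>
     (\<integral>\<^sup>+x. ennreal ((1 + (norm (grad_log h \<theta> x))\<^sup>2) * (h \<theta> x / h\<psi> x)\<^sup>2) \<partial>prob_of \<mu> h\<psi>) < \<infinity>"

end

theory Submission
  imports Defs "HOL-Real_Asymp.Real_Asymp"
begin

text \<open>
  Write \<open>P\<close> for the data distribution, \<open>Q\<close> for the artificial one, \<open>r = dP/dQ\<close>, and let
  \<open>g = (\<nabla> log h, 1)\<close> be the extended score at the true parameter. Both estimators are
  instances of one construction with a weight \<open>\<rho>\<close>: the variance is \<open>J\<^sup>-\<^sup>1 B J\<^sup>-\<^sup>1\<close> with
  \<open>J = E\<^sub>P[\<rho> g g\<^sup>T]\<close> and \<open>B = V\<^sub>P(\<rho> g) + V\<^sub>Q(r \<rho> g) / \<tau>\<close>, where \<open>\<rho> = 1\<close> for importance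
  sampling and \<open>\<rho> = R = 1 / w\<close> with \<open>w = 1 + r / \<tau>\<close> for noise-contrastive estimation.

  Moving everything under \<open>P\<close> gives \<open>B = E\<^sub>P[\<rho>\<^sup>2 w g g\<^sup>T] - (1 + 1/\<tau>) m m\<^sup>T\<close> with
  \<open>m = E\<^sub>P[\<rho> g]\<close>. Since the last coordinate of \<open>g\<close> is \<open>1\<close>, \<open>m = J e\<close> with \<open>e\<close> the last unit
  vector, so the centering term becomes \<open>(1 + 1/\<tau>) e e\<^sup>T\<close> after the sandwich, whatever
  \<open>\<rho>\<close> is (lemma \<open>sandwich_covariances\<close>). It cancels in the difference of the two variances. For
  \<open>\<rho> = 1 / w\<close> the rest of the sandwich is \<open>E\<^sub>P[w\<^sup>-\<^sup>1 g g\<^sup>T]\<^sup>-\<^sup>1\<close>, and what remains to show is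
  \<open>E\<^sub>P[g g\<^sup>T]\<^sup>-\<^sup>1 E\<^sub>P[w g g\<^sup>T] E\<^sub>P[g g\<^sup>T]\<^sup>-\<^sup>1 \<succeq> E\<^sub>P[w\<^sup>-\<^sup>1 g g\<^sup>T]\<^sup>-\<^sup>1\<close>,
  a matrix form of the Cauchy--Schwarz inequality (lemma \<open>weighted_gram_inverse_le\<close>).

  The hypotheses of the statement enter as follows. Absolute continuity makes
  \<open>r\<close> a density of \<open>P\<close> with respect to \<open>Q\<close>. The two integrability conditions give
  the second moments of \<open>g\<close> under \<open>P\<close> and of \<open>r g\<close> under \<open>Q\<close>. Invertibility of the Fisher
  information makes all the Gram matrices invertible: a linear combination of the coordinates of
  \<open>g\<close> that vanishes almost surely would be a direction in which the score is constant. Finally,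
  differentiability of \<open>h\<close> almost everywhere makes the score a limit of difference quotients, hence
  almost everywhere equal to a measurable function (lemma \<open>borel_measurable_version_of_score\<close>).
\<close>

section \<open>Outer products, Gram matrices and covariances\<close>

lemma borel_measurable_vecI:
  fixes f :: "'x \<Rightarrow> 'b::euclidean_space ^ 'n"
  assumes "\<And>i. (\<lambda>x. f x $ i) \<in> borel_measurable M"
  shows "f \<in> borel_measurable M"
proof (rule borel_measurable_euclidean_space[THEN iffD2], rule ballI)
  fix b :: "'b ^ 'n" assume "b \<in> Basis"
  then obtain i u where "b = axis i u" "u \<in> Basis" by (auto simp: Basis_vec_def)
  then show "(\<lambda>x. f x \<bullet> b) \<in> borel_measurable M"
    using assms[of i] by (simp add: inner_axis borel_measurable_inner)
qed

lemma borel_measurable_vec_nth [measurable (raw)]: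
  fixes f :: "'x \<Rightarrow> 'b::euclidean_space ^ 'n"
  assumes "f \<in> borel_measurable M"
  shows "(\<lambda>x. f x $ i) \<in> borel_measurable M"
  using assms by (rule measurable_compose) (intro borel_measurable_continuous_onI continuous_intros)

lemma borel_measurable_outer [measurable (raw)]:
  fixes f g :: "'x \<Rightarrow> real ^ 'n"
  assumes [measurable]: "f \<in> borel_measurable M" "g \<in> borel_measurable M"
  shows "(\<lambda>x. outer (f x) (g x)) \<in> borel_measurable M"
  by (intro borel_measurable_vecI) (simp add: outer_def)

lemma outer_mult_vec: "outer v w *v u = (w \<bullet> u) *\<^sub>R v"
  by (simp add: outer_def matrix_vector_mult_def vec_eq_iff inner_vec_def sum_distrib_left ac_simps)

lemma norm_outer: "norm (outer v w) = norm v * norm w"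
proof -
  have "norm (outer v w $ i) = norm (v $ i) * norm w" for i
  proof -
    have "outer v w $ i = v $ i *\<^sub>R w" by (simp add: outer_def vec_eq_iff)
    then show ?thesis by simp
  qed
  then have "norm (outer v w) = L2_set (\<lambda>i. norm (v $ i) * norm w) UNIV"
    by (simp add: norm_vec_def[of "outer v w"])
  then show ?thesis
    by (simp add: norm_vec_def[of v] L2_set_left_distrib)
qed

lemma outer_matrix_mult: "A ** outer v w ** B = outer (A *v v) (transpose B *v w)"
  by (simp add: outer_def matrix_matrix_mult_def matrix_vector_mult_def transpose_def vec_eq_iff
        sum_distrib_left sum_distrib_right ac_simps)

lemma outer_diff_left: "outer (u - v) w = outer u w - outer v w"
  and outer_diff_right: "outer u (v - w) = outer u v - outer u w"
  and outer_scaleR_left: "outer (c *\<^sub>R v) w = c *\<^sub>R outer v w"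
  and outer_scaleR_right: "outer v (c *\<^sub>R w) = c *\<^sub>R outer v w"
  by (simp_all add: outer_def vec_eq_iff algebra_simps)

lemma matrix_inv_eq:
  fixes A :: "real^'n^'n"
  assumes "invertible A"
  shows "matrix_inv A ** A = mat 1" "A ** matrix_inv A = mat 1"
  using assms someI_ex[of "\<lambda>A'. A ** A' = mat 1 \<and> A' ** A = mat 1"]
  unfolding invertible_def matrix_inv_def by auto

lemma transpose_matrix_inv:
  fixes A :: "real^'n^'n"
  assumes "invertible A" "transpose A = A"
  shows "transpose (matrix_inv A) = matrix_inv A"
proof -
  let ?B = "matrix_inv A"
  have "transpose ?B ** A = mat 1"
    using arg_cong[OF matrix_inv_eq(2)[OF assms(1)], of transpose] assms(2)
    by (simp add: matrix_transpose_mul transpose_mat)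
  then have "transpose ?B = transpose ?B ** (A ** ?B)" "(transpose ?B ** A) ** ?B = ?B"
    using matrix_inv_eq(2)[OF assms(1)] by (simp_all add: matrix_mul_rid matrix_mul_lid)
  then show ?thesis by (simp add: matrix_mul_assoc)
qed

lemma bounded_linear_matrix_mult_left_right:
  fixes A :: "real^'n^'m" and B :: "real^'p^'q"
  shows "bounded_linear (\<lambda>X. A ** X ** B)"
  unfolding linear_conv_bounded_linear[symmetric]
  by (rule linearI)
     (simp_all add: matrix_matrix_mult_def vec_eq_iff algebra_simps sum.distrib sum_distrib_left)

lemma bounded_linear_matrix_vector_mult_left: "bounded_linear (\<lambda>X::real^'n^'m. X *v v)"
  unfolding linear_conv_bounded_linear[symmetric]
  by (rule linearI)
     (simp_all add: matrix_vector_mult_def vec_eq_iff algebra_simps sum.distrib sum_distrib_left)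

lemma bounded_linear_transpose: "bounded_linear (transpose :: real^'n^'m \<Rightarrow> real^'m^'n)"
  unfolding linear_conv_bounded_linear[symmetric]
  by (rule linearI) (simp_all add: transpose_def vec_eq_iff)

text \<open>
  The positive semi-definite matrices form a closed convex cone; a divergent Bochner integral is
  \<open>0\<close>, which lies in the cone as well. For weighted Gram matrices this also yields symmetry.
\<close>

lemma psd_integral:
  fixes F :: "'x \<Rightarrow> real^'n^'n"
  assumes "\<And>x. x \<in> space M \<Longrightarrow> psd (F x)"
  shows "psd (\<integral>x. F x \<partial>M)"
proof (cases "integrable M F")
  case True
  have "transpose (\<integral>x. F x \<partial>M) = (\<integral>x. transpose (F x) \<partial>M)"
    using True by (rule integral_bounded_linear[OF bounded_linear_transpose, symmetric])
  also have "\<dots> = (\<integral>x. F x \<partial>M)"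
    using assms by (intro Bochner_Integration.integral_cong) (auto simp: psd_def)
  finally have sym: "transpose (\<integral>x. F x \<partial>M) = (\<integral>x. F x \<partial>M)" .
  have "v \<bullet> ((\<integral>x. F x \<partial>M) *v v) = (\<integral>x. v \<bullet> (F x *v v) \<partial>M)" for v
    using integral_bounded_linear[OF bounded_linear_compose
        [OF bounded_linear_inner_right bounded_linear_matrix_vector_mult_left] True, of v v] by simp
  moreover have "0 \<le> (\<integral>x. v \<bullet> (F x *v v) \<partial>M)" for v
    using assms by (intro integral_nonneg_AE AE_I2) (auto simp: psd_def)
  ultimately show ?thesis using sym by (simp add: psd_def)
qed (simp add: not_integrable_integral_eq psd_def transpose_def vec_eq_iff)

lemma psd_scaleR_outer: "0 \<le> c \<Longrightarrow> psd (c *\<^sub>R outer v v)"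
proof -
  assume "0 \<le> c"
  have "u \<bullet> ((c *\<^sub>R outer v v) *v u) = c * (v \<bullet> u)\<^sup>2" for u
    by (simp add: scaleR_matrix_vector_assoc[symmetric] outer_mult_vec inner_commute power2_eq_square)
  moreover have "transpose (c *\<^sub>R outer v v) = c *\<^sub>R outer v v"
    by (simp add: outer_def transpose_def vec_eq_iff)
  ultimately show ?thesis using \<open>0 \<le> c\<close> by (simp add: psd_def)
qed

text \<open>
  A matrix Cauchy--Schwarz inequality. With \<open>A = E[w g g\<^sup>T]\<close>, \<open>J = E[g g\<^sup>T]\<close> and
  \<open>K = E[w\<^sup>-\<^sup>1 g g\<^sup>T]\<close>, the difference \<open>J\<^sup>-\<^sup>1 A J\<^sup>-\<^sup>1 - K\<^sup>-\<^sup>1\<close> is itself a weighted Gram matrix,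
  namely that of the residual \<open>\<phi> = J\<^sup>-\<^sup>1 g - w\<^sup>-\<^sup>1 K\<^sup>-\<^sup>1 g\<close> with weight \<open>w\<close>: both cross terms of
  the expansion equal \<open>K\<^sup>-\<^sup>1\<close>, and so does the last square.
\<close>

lemma weighted_gram_inverse_le:
  fixes g :: "'x \<Rightarrow> real^'n"
  assumes w: "\<And>x. x \<in> space P \<Longrightarrow> 0 < w x"
  assumes iA: "integrable P (\<lambda>x. w x *\<^sub>R outer (g x) (g x))"
    and iJ: "integrable P (\<lambda>x. outer (g x) (g x))"
    and iK: "integrable P (\<lambda>x. (1 / w x) *\<^sub>R outer (g x) (g x))"
  defines "A \<equiv> \<integral>x. w x *\<^sub>R outer (g x) (g x) \<partial>P"
    and "J \<equiv> \<integral>x. outer (g x) (g x) \<partial>P"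
    and "K \<equiv> \<integral>x. (1 / w x) *\<^sub>R outer (g x) (g x) \<partial>P"
  assumes J: "invertible J" and K: "invertible K"
  shows "psd (matrix_inv J ** A ** matrix_inv J - matrix_inv K)"
proof -
  let ?J = "matrix_inv J" and ?K = "matrix_inv K"
  define \<phi> where "\<phi> x = ?J *v g x - (1 / w x) *\<^sub>R (?K *v g x)" for x
  have symJ: "transpose J = J" and symK: "transpose K = K"
    unfolding J_def K_def using w
    by (auto intro!: psd_integral[unfolded psd_def, THEN conjunct1] psd_scaleR_outer[unfolded psd_def]
        psd_scaleR_outer[of 1, simplified, unfolded psd_def] simp: less_imp_le)
  note T = transpose_matrix_inv[OF J symJ] transpose_matrix_inv[OF K symK]
  have expand: "w x *\<^sub>R outer (\<phi> x) (\<phi> x) =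
      ?J ** (w x *\<^sub>R outer (g x) (g x)) ** ?J - ?J ** outer (g x) (g x) ** ?K
      - ?K ** outer (g x) (g x) ** ?J + ?K ** ((1 / w x) *\<^sub>R outer (g x) (g x)) ** ?K"
    if "x \<in> space P" for x
    using w[OF that]
    by (simp add: \<phi>_def outer_diff_left outer_diff_right outer_scaleR_left outer_scaleR_right
        outer_matrix_mult T matrix_scalar_ac scalar_matrix_assoc[symmetric] algebra_simps)
  have "(\<integral>x. w x *\<^sub>R outer (\<phi> x) (\<phi> x) \<partial>P) =
      (\<integral>x. ?J ** (w x *\<^sub>R outer (g x) (g x)) ** ?J - ?J ** outer (g x) (g x) ** ?K
      - ?K ** outer (g x) (g x) ** ?J + ?K ** ((1 / w x) *\<^sub>R outer (g x) (g x)) ** ?K \<partial>P)"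
    using expand by (intro Bochner_Integration.integral_cong) auto
  also have "\<dots> = ?J ** A ** ?J - ?J ** J ** ?K - ?K ** J ** ?J + ?K ** K ** ?K"
  proof -
    note bl = bounded_linear_matrix_mult_left_right
    note [simp] = integrable_bounded_linear[OF bl] integral_bounded_linear[OF bl]
    show ?thesis unfolding A_def J_def K_def using iA iJ iK by simp
  qed
  also have "\<dots> = ?J ** A ** ?J - ?K"
  proof -
    have "?K ** J ** ?J = ?K"
      by (simp add: matrix_inv_eq[OF J] matrix_mul_assoc[symmetric] matrix_mul_rid)
    then show ?thesis
      by (simp add: matrix_inv_eq[OF J] matrix_inv_eq[OF K] matrix_mul_lid)
  qed
  finally have "?J ** A ** ?J - ?K = (\<integral>x. w x *\<^sub>R outer (\<phi> x) (\<phi> x) \<partial>P)" by simp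
  then show ?thesis using w by (auto intro!: psd_integral psd_scaleR_outer less_imp_le)
qed

text \<open>
  Subsets of null sets are measurable for the completion, so altering a measurable function on a
  null set does no harm. This is how gradients that exist only almost everywhere are handled.
\<close>

lemma borel_measurable_completion_AE_eq:
  fixes f g :: "'x \<Rightarrow> 'b::topological_space"
  assumes g: "g \<in> borel_measurable M" and eq: "AE x in M. f x = g x"
  shows "f \<in> borel_measurable (completion M)"
proof (rule measurableI)
  fix S :: "'b set" assume S: "S \<in> sets borel"
  have [measurable]: "Measurable.pred (completion M) (\<lambda>x. g x \<in> S)"
    using measurable_completion[OF g] S by measurable
  have [measurable]: "Measurable.pred (completion M) (\<lambda>x. f x \<noteq> g x)"
    "Measurable.pred (completion M) (\<lambda>x. f x \<noteq> g x \<and> f x \<in> S)"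
    using eq by (auto intro!: sets_completion_AE elim: eventually_mono)
  have "Measurable.pred (completion M)
      (\<lambda>x. (g x \<in> S \<and> \<not> f x \<noteq> g x) \<or> (f x \<noteq> g x \<and> f x \<in> S))"
    by measurable
  also have "(\<lambda>x. (g x \<in> S \<and> \<not> f x \<noteq> g x) \<or> (f x \<noteq> g x \<and> f x \<in> S)) = (\<lambda>x. f x \<in> S)"
    by auto
  finally show "f -` S \<inter> space (completion M) \<in> sets (completion M)"
    by (simp add: pred_def vimage_def Int_def conj_commute)
qed auto

lemma expct_eq_integral:
  assumes g: "g \<in> borel_measurable P" and eq: "AE x in P. f x = g x"
  shows "expct P f = (\<integral>x. g x \<partial>P)"
proof -
  have "expct P f = (\<integral>x. g x \<partial>completion P)"
    unfolding expct_def
    using borel_measurable_completion_AE_eq[OF assms] measurable_completion[OF g] AE_completion[OF eq]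
    by (rule integral_cong_AE)
  then show ?thesis using integral_completion[OF g] by simp
qed

text \<open>
  The usual identity \<open>V(Y) = E[Y Y\<^sup>T] - E[Y] E[Y]\<^sup>T\<close>, for a function that is only almost
  everywhere equal to a measurable one.
\<close>

lemma covar_eq_moments:
  fixes f g :: "'x \<Rightarrow> real^'n"
  assumes P: "prob_space P" and eq: "AE x in P. f x = g x"
    and i1: "integrable P g" and i2: "integrable P (\<lambda>x. outer (g x) (g x))"
  shows "covar P f = (\<integral>x. outer (g x) (g x) \<partial>P) - outer (\<integral>x. g x \<partial>P) (\<integral>x. g x \<partial>P)"
proof -
  interpret prob_space P by fact
  let ?m = "\<integral>x. g x \<partial>P"
  have [measurable]: "g \<in> borel_measurable P" using i1 by auto
  have m: "expct P f = ?m" using eq by (intro expct_eq_integral) auto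
  have "covar P f = (\<integral>x. outer (g x - ?m) (g x - ?m) \<partial>P)"
    unfolding covar_def m using eq by (intro expct_eq_integral) (auto elim: eventually_mono)
  also have "\<dots> = (\<integral>x. outer (g x) (g x) - outer (g x) ?m - outer ?m (g x) + outer ?m ?m \<partial>P)"
    by (simp add: outer_diff_left outer_diff_right algebra_simps)
  also have "\<dots> = (\<integral>x. outer (g x) (g x) \<partial>P) - outer ?m ?m - outer ?m ?m + outer ?m ?m"
  proof -
    have bl: "bounded_linear (\<lambda>v. outer v ?m)" "bounded_linear (\<lambda>v. outer ?m v)"
      unfolding linear_conv_bounded_linear[symmetric]
      by (rule linearI; simp add: outer_def vec_eq_iff algebra_simps)+
    show ?thesis
      using i1 i2 integrable_bounded_linear[OF bl(1) i1] integrable_bounded_linear[OF bl(2) i1]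
        integral_bounded_linear[OF bl(1) i1] integral_bounded_linear[OF bl(2) i1]
      by (simp add: prob_space)
  qed
  finally show ?thesis by simp
qed

section \<open>Sandwich covariances in a model with an intercept\<close>

text \<open>
  The probabilistic content of the comparison, freed from the parametrisation of the model: \<open>P\<close> is
  the data distribution, \<open>Q\<close> the artificial one, \<open>r\<close> the likelihood ratio and \<open>g\<close> the extended score,
  whose coordinate \<open>k\<close> is the derivative in the intercept and hence constant. The factor
  \<open>1 + r\<close> in the moment assumption covers at once the second moments of \<open>g\<close> under \<open>P\<close>
  and those of \<open>r g\<close> under \<open>Q\<close>.
\<close>

locale score_moments = Q: prob_space Q + P: prob_space P
  for Q P :: "'x measure" +
  fixes r :: "'x \<Rightarrow> real" and g :: "'x \<Rightarrow> real^'m" and k :: 'm and \<tau> :: real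
  assumes r_meas [measurable]: "r \<in> borel_measurable Q"
    and r_nonneg: "\<And>x. x \<in> space Q \<Longrightarrow> 0 \<le> r x"
    and P_eq: "P = density Q (\<lambda>x. ennreal (r x))"
    and g_meas [measurable]: "g \<in> borel_measurable Q"
    and g_const: "\<And>x. x \<in> space Q \<Longrightarrow> g x $ k = 1"
    and second_moments: "integrable P (\<lambda>x. (1 + r x) * (norm (g x))\<^sup>2)"
    and \<tau>_pos: "0 < \<tau>"
    and nondegenerate: "\<And>v. (AE x in P. v \<bullet> g x = 0) \<Longrightarrow> v = 0"
begin

abbreviation G :: "'x \<Rightarrow> real^'m^'m" where "G x \<equiv> outer (g x) (g x)"

lemma sets_P [measurable_cong]: "sets P = sets Q"
  by (simp add: P_eq)

lemma space_P: "space P = space Q"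
  by (simp add: P_eq)

lemma one_le_norm_g: "x \<in> space Q \<Longrightarrow> 1 \<le> norm (g x)"
  using g_const[of x] component_le_norm_cart[of "g x" k] by simp

text \<open>
  The first moment is controlled by the second because the constant coordinate forces
  \<open>norm (g x) \<ge> 1\<close>.
\<close>

lemma integrable_moment:
  assumes [measurable]: "c \<in> borel_measurable Q"
    and c: "\<And>x. x \<in> space Q \<Longrightarrow> \<bar>c x\<bar> \<le> C * (1 + r x)"
  shows "integrable P (\<lambda>x. c x *\<^sub>R G x)" "integrable P (\<lambda>x. c x *\<^sub>R g x)"
proof -
  have i: "integrable P (\<lambda>x. C * ((1 + r x) * (norm (g x))\<^sup>2))"
    using second_moments by simp
  have b1: "\<bar>c x\<bar> * (norm (g x))\<^sup>2 \<le> C * ((1 + r x) * (norm (g x))\<^sup>2)" if "x \<in> space Q" for x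
    using mult_right_mono[OF c[OF that], of "(norm (g x))\<^sup>2"] by (simp add: mult.assoc)
  have b2: "\<bar>c x\<bar> * norm (g x) \<le> C * ((1 + r x) * (norm (g x))\<^sup>2)" if "x \<in> space Q" for x
  proof -
    have "norm (g x) \<le> (norm (g x))\<^sup>2"
      using one_le_norm_g[OF that] by (simp add: power2_eq_square mult_le_cancel_left1)
    then have "\<bar>c x\<bar> * norm (g x) \<le> \<bar>c x\<bar> * (norm (g x))\<^sup>2" by (intro mult_left_mono) auto
    with b1[OF that] show ?thesis by simp
  qed
  show "integrable P (\<lambda>x. c x *\<^sub>R G x)"
    by (rule Bochner_Integration.integrable_bound[OF i])
       (auto intro!: AE_I2 order_trans[OF b1 abs_ge_self]
          simp: norm_outer space_P power2_eq_square[symmetric])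
  show "integrable P (\<lambda>x. c x *\<^sub>R g x)"
    by (rule Bochner_Integration.integrable_bound[OF i])
       (auto intro!: AE_I2 order_trans[OF b2 abs_ge_self] simp: space_P)
qed

lemma integral_P:
  fixes f :: "'x \<Rightarrow> 'b::{banach, second_countable_topology}"
  assumes "f \<in> borel_measurable Q"
  shows "(\<integral>x. f x \<partial>P) = (\<integral>x. r x *\<^sub>R f x \<partial>Q)"
    and "integrable P f \<longleftrightarrow> integrable Q (\<lambda>x. r x *\<^sub>R f x)"
  unfolding P_eq using r_nonneg
  by (intro integral_density integrable_density assms r_meas AE_I2; simp)+

text \<open>
  A vector in the kernel of \<open>E[\<rho> g g\<^sup>T]\<close> satisfies \<open>E[\<rho> (v \<bullet> g)\<^sup>2] = 0\<close>; as \<open>\<rho>\<close> is positive,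
  \<open>v \<bullet> g\<close> vanishes almost surely, so \<open>v = 0\<close> by nondegeneracy.
\<close>

lemma gram_invertible:
  assumes [measurable]: "\<rho> \<in> borel_measurable Q"
    and \<rho>: "\<And>x. x \<in> space Q \<Longrightarrow> 0 < \<rho> x \<and> \<rho> x \<le> 1"
  shows "invertible (\<integral>x. \<rho> x *\<^sub>R G x \<partial>P)"
  unfolding invertible_left_inverse matrix_left_invertible_ker
proof (intro allI impI)
  fix v assume v: "(\<integral>x. \<rho> x *\<^sub>R G x \<partial>P) *v v = 0"
  have "\<bar>\<rho> x\<bar> \<le> 1 * (1 + r x)" if "x \<in> space Q" for x
    using \<rho>[OF that] r_nonneg[OF that] by simp
  then have i: "integrable P (\<lambda>x. \<rho> x *\<^sub>R G x)" by (intro integrable_moment[where C = 1]) auto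
  note bl = bounded_linear_compose
    [OF bounded_linear_inner_right bounded_linear_matrix_vector_mult_left, of v v]
  have eq: "v \<bullet> ((\<rho> x *\<^sub>R G x) *v v) = \<rho> x * (v \<bullet> g x)\<^sup>2" for x
    by (simp add: scaleR_matrix_vector_assoc[symmetric] outer_mult_vec inner_commute power2_eq_square)
  have "(\<integral>x. \<rho> x * (v \<bullet> g x)\<^sup>2 \<partial>P) = 0"
    using integral_bounded_linear[OF bl i] v by (simp add: eq)
  moreover have "integrable P (\<lambda>x. \<rho> x * (v \<bullet> g x)\<^sup>2)"
    using integrable_bounded_linear[OF bl i] by (simp add: eq)
  ultimately have "AE x in P. \<rho> x * (v \<bullet> g x)\<^sup>2 = 0"
    using \<rho> by (subst (asm) integral_nonneg_eq_0_iff_AE) (auto intro!: AE_I2 simp: space_P less_imp_le)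
  then have "AE x in P. v \<bullet> g x = 0"
    using AE_space by eventually_elim (use \<rho> in \<open>fastforce simp: space_P\<close>)
  then show "v = 0" by (rule nondegenerate)
qed

text \<open>
  Both estimators are covered: \<open>\<rho> = 1\<close> is importance sampling, and \<open>\<rho> = 1 / (1 + r / \<tau>)\<close> is
  noise-contrastive estimation. The two covariances have the same mean \<open>m = E\<^sub>P[\<rho> g]\<close>, since
  \<open>E\<^sub>Q[r \<phi>] = E\<^sub>P[\<phi>]\<close>. As coordinate \<open>k\<close> of \<open>g\<close> is \<open>1\<close>, this mean is column \<open>k\<close> of
  \<open>J = E\<^sub>P[\<rho> g g\<^sup>T]\<close>, so that \<open>J\<^sup>-\<^sup>1 m\<close> is a coordinate vector and centering contributes a
  term that does not depend on \<open>\<rho>\<close>.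
\<close>

lemma sandwich_covariances:
  assumes [measurable]: "\<rho> \<in> borel_measurable Q"
    and \<rho>: "\<And>x. x \<in> space Q \<Longrightarrow> 0 < \<rho> x \<and> \<rho> x \<le> 1"
    and f1: "AE x in P. f1 x = \<rho> x *\<^sub>R g x"
    and f2: "AE x in Q. f2 x = (r x * \<rho> x) *\<^sub>R g x"
  defines "J \<equiv> \<integral>x. \<rho> x *\<^sub>R G x \<partial>P"
  shows "matrix_inv J ** (covar P f1 + (1 / \<tau>) *\<^sub>R covar Q f2) ** matrix_inv J =
      matrix_inv J ** (\<integral>x. ((\<rho> x)\<^sup>2 * (1 + r x / \<tau>)) *\<^sub>R G x \<partial>P) ** matrix_inv J
      - (1 + 1 / \<tau>) *\<^sub>R outer (axis k 1) (axis k 1)"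
proof -
  let ?Ji = "matrix_inv J" and ?m = "\<integral>x. \<rho> x *\<^sub>R g x \<partial>P"
  have b0: "\<bar>\<rho> x\<bar> \<le> 1 * (1 + r x)" and b1: "\<bar>(\<rho> x)\<^sup>2\<bar> \<le> 1 * (1 + r x)"
    and b2: "\<bar>r x * (\<rho> x)\<^sup>2\<bar> \<le> 1 * (1 + r x)" if "x \<in> space Q" for x
  proof -
    have "(\<rho> x)\<^sup>2 \<le> 1" "0 \<le> r x" "0 < \<rho> x" "\<rho> x \<le> 1"
      using \<rho>[OF that] r_nonneg[OF that] by (auto simp: power_le_one)
    moreover then have "r x * (\<rho> x)\<^sup>2 \<le> r x * 1" by (intro mult_left_mono) auto
    ultimately show "\<bar>\<rho> x\<bar> \<le> 1 * (1 + r x)" "\<bar>(\<rho> x)\<^sup>2\<bar> \<le> 1 * (1 + r x)"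
      "\<bar>r x * (\<rho> x)\<^sup>2\<bar> \<le> 1 * (1 + r x)" by auto
  qed
  have i\<rho>: "integrable P (\<lambda>x. \<rho> x *\<^sub>R G x)" "integrable P (\<lambda>x. \<rho> x *\<^sub>R g x)"
    using b0 by (intro integrable_moment[where C = 1]; simp)+
  have i1: "integrable P (\<lambda>x. (\<rho> x)\<^sup>2 *\<^sub>R G x)" using b1 by (intro integrable_moment[where C = 1]) auto
  have i2: "integrable P (\<lambda>x. (r x * (\<rho> x)\<^sup>2) *\<^sub>R G x)" using b2 by (intro integrable_moment[where C = 1]) auto
  have e1: "outer (\<rho> x *\<^sub>R g x) (\<rho> x *\<^sub>R g x) = (\<rho> x)\<^sup>2 *\<^sub>R G x"
    and e2: "outer ((r x * \<rho> x) *\<^sub>R g x) ((r x * \<rho> x) *\<^sub>R g x)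
      = r x *\<^sub>R ((r x * (\<rho> x)\<^sup>2) *\<^sub>R G x)" for x
    by (simp_all add: outer_scaleR_left outer_scaleR_right power2_eq_square ac_simps)
  have C1: "covar P f1 = (\<integral>x. (\<rho> x)\<^sup>2 *\<^sub>R G x \<partial>P) - outer ?m ?m"
    using covar_eq_moments[OF P.prob_space_axioms f1] i\<rho>(2) i1 by (simp add: e1)
  have C2: "covar Q f2 = (\<integral>x. (r x * (\<rho> x)\<^sup>2) *\<^sub>R G x \<partial>P) - outer ?m ?m"
  proof -
    have "integrable Q (\<lambda>x. (r x * \<rho> x) *\<^sub>R g x)" "(\<integral>x. (r x * \<rho> x) *\<^sub>R g x \<partial>Q) = ?m"
      using i\<rho>(2) integral_P[of "\<lambda>x. \<rho> x *\<^sub>R g x"] by simp_all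
    moreover have "integrable Q (\<lambda>x. outer ((r x * \<rho> x) *\<^sub>R g x) ((r x * \<rho> x) *\<^sub>R g x))"
      unfolding e2 using i2 by (subst integral_P(2)[symmetric]) auto
    moreover have "(\<integral>x. outer ((r x * \<rho> x) *\<^sub>R g x) ((r x * \<rho> x) *\<^sub>R g x) \<partial>Q)
        = (\<integral>x. (r x * (\<rho> x)\<^sup>2) *\<^sub>R G x \<partial>P)"
      unfolding e2 by (subst integral_P(1)[symmetric]) auto
    ultimately show ?thesis using covar_eq_moments[OF Q.prob_space_axioms f2] by simp
  qed
  have sum: "covar P f1 + (1 / \<tau>) *\<^sub>R covar Q f2 =
      (\<integral>x. ((\<rho> x)\<^sup>2 * (1 + r x / \<tau>)) *\<^sub>R G x \<partial>P) - (1 + 1 / \<tau>) *\<^sub>R outer ?m ?m"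
  proof -
    have "((\<rho> x)\<^sup>2 * (1 + r x / \<tau>)) *\<^sub>R G x =
        (\<rho> x)\<^sup>2 *\<^sub>R G x + (1 / \<tau>) *\<^sub>R ((r x * (\<rho> x)\<^sup>2) *\<^sub>R G x)" for x
      by (simp add: algebra_simps)
    then have "(\<integral>x. ((\<rho> x)\<^sup>2 * (1 + r x / \<tau>)) *\<^sub>R G x \<partial>P) =
      (\<integral>x. (\<rho> x)\<^sup>2 *\<^sub>R G x \<partial>P) + (1 / \<tau>) *\<^sub>R (\<integral>x. (r x * (\<rho> x)\<^sup>2) *\<^sub>R G x \<partial>P)"
      using i1 i2 by (simp del: scaleR_scaleR)
    then show ?thesis unfolding C1 C2 by (simp add: algebra_simps)
  qed
  have "?m = J *v axis k 1"
  proof -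
    have "J *v axis k 1 = (\<integral>x. (\<rho> x *\<^sub>R G x) *v axis k 1 \<partial>P)"
      unfolding J_def by (rule integral_bounded_linear
        [OF bounded_linear_matrix_vector_mult_left i\<rho>(1), symmetric])
    also have "\<dots> = ?m"
      by (intro Bochner_Integration.integral_cong)
        (auto simp: scaleR_matrix_vector_assoc[symmetric] outer_mult_vec inner_axis g_const space_P)
    finally show ?thesis ..
  qed
  then have m: "?Ji *v ?m = axis k 1"
    using matrix_inv_eq(1)[OF gram_invertible[OF assms(1) \<rho>]]
    by (simp add: J_def matrix_vector_mul_assoc)
  have "transpose J = J"
    unfolding J_def using \<rho>
    by (auto intro!: psd_integral[unfolded psd_def, THEN conjunct1]
        psd_scaleR_outer[unfolded psd_def] simp: space_P less_imp_le)
  then have "?Ji ** outer ?m ?m ** ?Ji = outer (axis k 1) (axis k 1)"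
    using transpose_matrix_inv[OF gram_invertible[OF assms(1) \<rho>]]
    by (simp add: outer_matrix_mult m J_def[symmetric])
  moreover have "?Ji ** (X - c *\<^sub>R Y) ** ?Ji = ?Ji ** X ** ?Ji - c *\<^sub>R (?Ji ** Y ** ?Ji)" for X Y c
  proof -
    have "linear (\<lambda>X. ?Ji ** X ** ?Ji)"
      by (intro bounded_linear.linear bounded_linear_matrix_mult_left_right)
    from linear_diff[OF this] linear_scale[OF this] show ?thesis by simp
  qed
  ultimately show ?thesis unfolding sum by simp
qed

text \<open>
  For \<open>\<rho> = 1 / w\<close> the middle matrix \<open>E\<^sub>P[\<rho>\<^sup>2 w g g\<^sup>T]\<close> of the sandwich collapses to
  \<open>K = E\<^sub>P[\<rho> g g\<^sup>T]\<close>, so the sandwich is \<open>K\<^sup>-\<^sup>1\<close> up to the common centering term. The latter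
  cancels in the difference, and the inequality for inverses of weighted Gram matrices applies.
\<close>

lemma sandwich_loewner_le:
  defines "w \<equiv> \<lambda>x. 1 + r x / \<tau>"
  assumes N: "AE x in P. fN x = (1 / w x) *\<^sub>R g x" "AE x in Q. gN x = (r x * (1 / w x)) *\<^sub>R g x"
    and I: "AE x in P. fI x = g x" "AE x in Q. gI x = r x *\<^sub>R g x"
  defines "K \<equiv> \<integral>x. (1 / w x) *\<^sub>R G x \<partial>P" and "J \<equiv> \<integral>x. G x \<partial>P"
  shows "loewner_le
      (matrix_inv K ** (covar P fN + (1 / \<tau>) *\<^sub>R covar Q gN) ** matrix_inv K)
      (matrix_inv J ** (covar P fI + (1 / \<tau>) *\<^sub>R covar Q gI) ** matrix_inv J)"
proof -
  have w [measurable]: "w \<in> borel_measurable Q" unfolding w_def by measurable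
  have w1: "1 \<le> w x" if "x \<in> space Q" for x
    using r_nonneg[OF that] \<tau>_pos by (simp add: w_def)
  have R: "0 < 1 / w x \<and> 1 / w x \<le> 1" if "x \<in> space Q" for x
    using w1[OF that] by (simp add: divide_simps)
  have one: "0 < (1::real) \<and> (1::real) \<le> 1" by simp
  have wb: "\<bar>w x\<bar> \<le> (1 + 1 / \<tau>) * (1 + r x)" if "x \<in> space Q" for x
    using r_nonneg[OF that] \<tau>_pos by (simp add: w_def algebra_simps add_nonneg_nonneg)
  have rb: "\<bar>1 / w x\<bar> \<le> 1 * (1 + r x)" if "x \<in> space Q" for x
    using R[OF that] r_nonneg[OF that] by simp
  have K: "invertible K" unfolding K_def by (rule gram_invertible[OF _ R]) measurable
  have J: "invertible J" using gram_invertible[of "\<lambda>_. 1"] by (simp add: J_def)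
  have "(\<integral>x. ((1 / w x)\<^sup>2 * (1 + r x / \<tau>)) *\<^sub>R G x \<partial>P) = K"
  proof -
    have "(1 / w x)\<^sup>2 * (1 + r x / \<tau>) = 1 / w x" if "x \<in> space P" for x
    proof -
      have "1 + r x / \<tau> = w x" by (simp add: w_def)
      then show ?thesis using w1[of x] that by (simp add: space_P power2_eq_square)
    qed
    then show ?thesis
      unfolding K_def by (intro Bochner_Integration.integral_cong) auto
  qed
  then have "matrix_inv K ** (covar P fN + (1 / \<tau>) *\<^sub>R covar Q gN) ** matrix_inv K =
      matrix_inv K - (1 + 1 / \<tau>) *\<^sub>R outer (axis k 1) (axis k 1)"
    using sandwich_covariances[of "\<lambda>x. 1 / w x", OF _ R N]
    by (simp add: K_def[symmetric] matrix_inv_eq[OF K] matrix_mul_lid)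
  moreover have "matrix_inv J ** (covar P fI + (1 / \<tau>) *\<^sub>R covar Q gI) ** matrix_inv J =
      matrix_inv J ** (\<integral>x. w x *\<^sub>R G x \<partial>P) ** matrix_inv J
      - (1 + 1 / \<tau>) *\<^sub>R outer (axis k 1) (axis k 1)"
    using sandwich_covariances[of "\<lambda>_. 1", OF _ one] I
    by (simp add: J_def[symmetric] w_def)
  moreover have "psd (matrix_inv J ** (\<integral>x. w x *\<^sub>R G x \<partial>P) ** matrix_inv J - matrix_inv K)"
    unfolding J_def K_def
  proof (rule weighted_gram_inverse_le)
    show "0 < w x" if "x \<in> space P" for x using w1[of x] that by (simp add: space_P)
    show "integrable P (\<lambda>x. w x *\<^sub>R G x)" using wb by (intro integrable_moment[where C = "1 + 1 / \<tau>"]) auto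
    show "integrable P G" using integrable_moment(1)[of "\<lambda>_. 1" 1] r_nonneg by simp
    show "integrable P (\<lambda>x. (1 / w x) *\<^sub>R G x)" using rb by (intro integrable_moment[where C = 1]) auto
  qed (use J K in \<open>simp_all add: J_def K_def\<close>)
  ultimately show ?thesis by (simp add: loewner_le_def)
qed

end

section \<open>Scores and their measurable versions\<close>

lemma grad_eqI:
  assumes "GDERIV f x :> D"
  shows "grad f x = D"
  unfolding grad_def
proof (rule the_equality)
  fix E assume "GDERIV f x :> E"
  then have "(\<lambda>h. h \<bullet> E) = (\<lambda>h. h \<bullet> D)"
    using assms unfolding gderiv_def by (rule has_derivative_unique)
  then show "E = D" by (metis vector_eq_ldot)
qed fact

lemma GDERIV_ln:
  assumes "GDERIV f x :> D" "0 < f x"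
  shows "GDERIV (\<lambda>t. ln (f t)) x :> D /\<^sub>R f x"
  using GDERIV_DERIV_compose[OF assms(1) DERIV_ln[OF assms(2)]] .

lemma flatten_nth [simp]: "flatten (a, b) $ Inl i = a $ i" "flatten (a, b) $ Inr j = b"
  by (simp_all add: flatten_def)

lemma flatten_surj: obtains a b where "v = flatten (a, b)"
proof
  show "v = flatten (\<chi> i. v $ Inl i, v $ Inr 1)"
    by (auto simp: flatten_def vec_eq_iff split: sum.split)
qed

lemma inner_flatten: "flatten (a, b) \<bullet> flatten (c, d) = a \<bullet> c + b * d"
  by (simp add: inner_vec_def sum.Plus UNIV_Plus_UNIV[symmetric])

lemma norm_flatten_sq: "(norm (flatten (a, b)))\<^sup>2 = (norm a)\<^sup>2 + b\<^sup>2"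
  by (metis inner_flatten power2_eq_square power2_norm_eq_inner)

lemma borel_measurable_flatten [measurable (raw)]:
  assumes [measurable]: "f \<in> borel_measurable M" "c \<in> borel_measurable M"
  shows "(\<lambda>x. flatten (f x, c x)) \<in> borel_measurable M"
proof (rule borel_measurable_vecI)
  fix i show "(\<lambda>x. flatten (f x, c x) $ i) \<in> borel_measurable M" by (cases i) simp_all
qed

lemma grad_ext_eq_flatten:
  assumes D: "GDERIV (\<lambda>t. h t x) \<theta> :> D" and pos: "0 < h \<theta> x"
  shows "grad_ext h (\<theta>, \<nu>) x = flatten (grad_log h \<theta> x, 1)"
proof -
  let ?D = "D /\<^sub>R h \<theta> x"
  have L: "GDERIV (\<lambda>t. ln (h t x)) \<theta> :> ?D" using D pos by (rule GDERIV_ln)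
  have "((\<lambda>\<zeta>. ln (h (fst \<zeta>) x)) has_derivative (\<lambda>z. fst z \<bullet> ?D)) (at (\<theta>, \<nu>))"
    using has_derivative_compose[OF has_derivative_fst[OF has_derivative_ident]] L
    by (fastforce simp: gderiv_def)
  from has_derivative_add[OF this has_derivative_snd[OF has_derivative_ident]]
  have "((\<lambda>\<zeta>. ext_model h \<zeta> x) has_derivative (\<lambda>z. fst z \<bullet> ?D + snd z)) (at (\<theta>, \<nu>))"
    by (simp add: ext_model_def)
  then have "GDERIV (\<lambda>\<zeta>. ext_model h \<zeta> x) (\<theta>, \<nu>) :> (?D, 1)"
    by (simp add: gderiv_def inner_prod_def)
  then show ?thesis
    using grad_eqI[OF L] by (simp add: grad_ext_def grad_log_def grad_eqI)
qed

text \<open>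
  The score is a limit of difference quotients wherever it exists. Taking the limit along a fixed
  sequence of steps gives a function that is measurable everywhere.
\<close>

lemma borel_measurable_version_of_score:
  fixes h :: "real^'d \<Rightarrow> 'x \<Rightarrow> real"
  assumes "open \<Theta>" "\<theta> \<in> \<Theta>" and meas: "\<And>t. t \<in> \<Theta> \<Longrightarrow> h t \<in> borel_measurable M"
  obtains s where "s \<in> borel_measurable M"
    "\<And>x D. GDERIV (\<lambda>t. h t x) \<theta> :> D \<Longrightarrow> 0 < h \<theta> x \<Longrightarrow> s x = grad_log h \<theta> x"
proof -
  obtain \<epsilon> where \<epsilon>: "0 < \<epsilon>" "ball \<theta> \<epsilon> \<subseteq> \<Theta>"
    using assms(1,2) openE by blast
  \<comment> \<open>The denominator keeps every step strictly below \<open>\<epsilon>\<close>, hence every shifted parameter in \<open>\<Theta>\<close>.\<close>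
  define \<delta> where "\<delta> n = \<epsilon> / (real n + 2)" for n
  have \<delta>: "0 < \<delta> n" "\<delta> n < \<epsilon>" for n
    using \<epsilon>(1) by (simp_all add: \<delta>_def divide_simps)
  have \<delta>0: "filterlim \<delta> (at 0) sequentially"
  proof -
    have "\<delta> \<longlonglongrightarrow> 0" unfolding \<delta>_def by real_asymp
    moreover have "\<delta> n \<noteq> 0" for n using \<delta>(1)[of n] by simp
    ultimately show ?thesis by (simp add: filterlim_at)
  qed
  define s where "s x = (\<chi> i. lim (\<lambda>n. (ln (h (\<theta> + \<delta> n *\<^sub>R axis i 1) x) - ln (h \<theta> x)) / \<delta> n))" for x
  have in_\<Theta>: "\<theta> + \<delta> n *\<^sub>R axis i 1 \<in> \<Theta>" for n i
    using \<epsilon>(2) \<delta>[of n] by (auto simp: dist_norm subset_iff)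
  have [measurable]: "h \<theta> \<in> borel_measurable M" "h (\<theta> + \<delta> n *\<^sub>R axis i 1) \<in> borel_measurable M" for n i
    using meas in_\<Theta> assms(2) by auto
  show thesis
  proof
    show "s \<in> borel_measurable M"
      by (rule borel_measurable_vecI) (simp add: s_def)
    fix x D assume D: "GDERIV (\<lambda>t. h t x) \<theta> :> D" and pos: "0 < h \<theta> x"
    let ?D = "D /\<^sub>R h \<theta> x"
    have L: "GDERIV (\<lambda>t. ln (h t x)) \<theta> :> ?D" using D pos by (rule GDERIV_ln)
    have "s x $ i = ?D $ i" for i
    proof -
      let ?F = "\<lambda>t. ln (h (\<theta> + t *\<^sub>R axis i 1) x)"
      have "((\<lambda>t. ln (h t x)) has_derivative (\<lambda>z. z \<bullet> ?D)) (at (\<theta> + 0 *\<^sub>R axis i 1))"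
        using L by (simp add: gderiv_def)
      moreover have "((\<lambda>t::real. \<theta> + t *\<^sub>R axis i 1) has_derivative (\<lambda>t. t *\<^sub>R axis i 1)) (at 0)"
        by (auto intro!: derivative_eq_intros)
      ultimately have "(?F has_derivative (\<lambda>t. (t *\<^sub>R axis i 1) \<bullet> ?D)) (at 0)"
        by (rule has_derivative_compose[rotated])
      then have "DERIV ?F 0 :> ?D $ i"
        unfolding has_field_derivative_def
        by (rule has_derivative_eq_rhs) (auto simp: inner_axis inner_commute)
      then have "((\<lambda>t. (?F t - ?F 0) / t) \<longlongrightarrow> ?D $ i) (at 0)"
        by (simp add: DERIV_def)
      from filterlim_compose[OF this \<delta>0] show ?thesis
        by (simp add: s_def limI)
    qed
    then show "s x = grad_log h \<theta> x"
      using grad_eqI[OF L] by (simp add: grad_log_def vec_eq_iff)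
  qed
qed

text \<open>
  A direction in which a random vector is almost surely constant lies in the kernel of its
  covariance. Read contrapositively for the score, it turns invertibility of the Fisher information
  into nondegeneracy of the extended score.
\<close>

lemma covar_mult_vec_eq_0:
  fixes f s :: "'x \<Rightarrow> real^'n"
  assumes P: "prob_space P" and eq: "AE x in P. f x = s x"
    and i1: "integrable P s" and i2: "integrable P (\<lambda>x. outer (s x) (s x))"
    and const: "AE x in P. u \<bullet> s x = a"
  shows "covar P f *v u = 0"
proof -
  interpret prob_space P by fact
  let ?m = "\<integral>x. s x \<partial>P"
  have [measurable]: "s \<in> borel_measurable P" using i1 by auto
  have "u \<bullet> ?m = (\<integral>x. u \<bullet> s x \<partial>P)"
    using i1 by simp
  also have "\<dots> = (\<integral>x. a \<partial>P)" using const by (intro integral_cong_AE) auto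
  finally have m: "?m \<bullet> u = a" by (simp add: prob_space inner_commute)
  have "(\<integral>x. outer (s x) (s x) \<partial>P) *v u = (\<integral>x. outer (s x) (s x) *v u \<partial>P)"
    by (rule integral_bounded_linear[OF bounded_linear_matrix_vector_mult_left i2, symmetric])
  also have "\<dots> = (\<integral>x. a *\<^sub>R s x \<partial>P)"
    unfolding outer_mult_vec using const
    by (intro integral_cong_AE) (auto simp: inner_commute elim: eventually_mono)
  finally show ?thesis
    using covar_eq_moments[OF P eq i1 i2] m
    by (simp add: matrix_vector_mult_diff_rdistrib outer_mult_vec)
qed

lemma prob_space_prob_of:
  assumes "unnormalized_density M f"
  shows "prob_space (prob_of M f)"
proof
  let ?Z = "normalizer M f"
  have f [measurable]: "f \<in> borel_measurable M" and i: "integrable M f" and Z: "0 < ?Z"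
    and nn: "AE x in M. 0 \<le> f x / ?Z"
    using assms by (auto simp: unnormalized_density_def intro!: AE_I2)
  have "emeasure (prob_of M f) (space M) = (\<integral>\<^sup>+x. ennreal (f x / ?Z) \<partial>M)"
    unfolding prob_of_def norm_density_def by (subst emeasure_density) (auto cong: nn_integral_cong)
  also have "\<dots> = ennreal (\<integral>x. f x / ?Z \<partial>M)"
    using i nn by (intro nn_integral_eq_integral) auto
  also have "\<dots> = 1" using Z by (simp add: normalizer_def)
  finally show "emeasure (prob_of M f) (space (prob_of M f)) = 1"
    by (simp add: prob_of_def)
qed

lemma AE_prob_of_iff:
  assumes "unnormalized_density M f"
  shows "(AE x in prob_of M f. R x) \<longleftrightarrow> (AE x in M. 0 < f x \<longrightarrow> R x)"
proof -
  have [measurable]: "f \<in> borel_measurable M" and Z: "0 < normalizer M f"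
    using assms by (auto simp: unnormalized_density_def)
  show ?thesis
    unfolding prob_of_def norm_density_def using Z by (subst AE_density) (auto simp: zero_less_divide_iff)
qed

text \<open>
  Where \<open>q\<close> vanishes, the right-hand measure has no mass; absolute continuity says that \<open>f\<close>
  vanishes there too, almost everywhere.
\<close>

lemma prob_of_eq_density:
  assumes f: "unnormalized_density M f" and q: "unnormalized_density M q"
    and ac: "absolutely_continuous (prob_of M q) (prob_of M f)"
  shows "prob_of M f = density (prob_of M q) (\<lambda>x. ennreal (norm_density M f x / norm_density M q x))"
proof -
  have [measurable]: "f \<in> borel_measurable M" "q \<in> borel_measurable M"
    and Z: "0 < normalizer M f" "0 < normalizer M q"
    and nn: "\<And>x. x \<in> space M \<Longrightarrow> 0 \<le> f x" "\<And>x. x \<in> space M \<Longrightarrow> 0 \<le> q x"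
    using f q by (auto simp: unnormalized_density_def)
  have "AE x in prob_of M q. 0 < q x" unfolding AE_prob_of_iff[OF q] by simp
  then have "AE x in prob_of M f. 0 < q x"
    using ac by (intro absolutely_continuous_AE[OF _ ac]) (auto simp: prob_of_def)
  then have pos: "AE x in M. 0 < f x \<longrightarrow> 0 < q x" unfolding AE_prob_of_iff[OF f] .
  have [measurable]: "norm_density M f \<in> borel_measurable M" "norm_density M q \<in> borel_measurable M"
    unfolding norm_density_def by measurable
  have "density (prob_of M q) (\<lambda>x. ennreal (norm_density M f x / norm_density M q x))
      = density M (\<lambda>x. ennreal (norm_density M q x) * ennreal (norm_density M f x / norm_density M q x))"
    unfolding prob_of_def by (rule density_density_eq) auto
  also have "\<dots> = density M (\<lambda>x. ennreal (norm_density M f x))"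
  proof (rule density_cong)
    show "AE x in M. ennreal (norm_density M q x) * ennreal (norm_density M f x / norm_density M q x)
        = ennreal (norm_density M f x)"
      using pos AE_space
    proof eventually_elim
      case (elim x)
      then have "f x = 0 \<or> 0 < q x" using nn(1)[of x] by auto
      moreover have "norm_density M q x * (norm_density M f x / norm_density M q x) = norm_density M f x"
        using calculation Z by (elim disjE) (simp_all add: norm_density_def)
      moreover have "0 \<le> norm_density M q x" "0 \<le> norm_density M f x / norm_density M q x"
        using nn[OF elim(2)] Z by (simp_all add: norm_density_def)
      ultimately show ?case by (metis ennreal_mult)
    qed
  qed measurable
  finally show ?thesis by (simp add: prob_of_def)
qed

section \<open>Comparison of the two asymptotic variances\<close>

theorem theorem5:
  fixes \<Theta> :: "(real^'d) set"
    and \<X> :: "(real^'k) set"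
    and \<mu> :: "(real^'k) measure"
    and h :: "real^'d \<Rightarrow> real^'k \<Rightarrow> real"
    and h\<psi> :: "real^'k \<Rightarrow> real"
    and \<theta>s :: "real^'d"
    and \<tau> :: real
    and M :: "'w measure"
    and X :: "nat \<Rightarrow> 'w \<Rightarrow> real^'k"
  assumes "open \<Theta>"
    and "space \<mu> = \<X>"
    and "\<And>\<theta>. \<theta> \<in> \<Theta> \<Longrightarrow> unnormalized_density \<mu> (h \<theta>)"
    and "inj_on (\<lambda>\<theta>. prob_of \<mu> (h \<theta>)) \<Theta>"
    and "unnormalized_density \<mu> h\<psi>"
    and "\<And>\<theta>. \<theta> \<in> \<Theta> \<Longrightarrow> absolutely_continuous (prob_of \<mu> h\<psi>) (prob_of \<mu> (h \<theta>))"
    and "\<theta>s \<in> \<Theta>"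
    and "0 < \<tau>"
    and "prob_space M"
    and "prob_space.indep_vars M (\<lambda>_. \<mu>) X {1..}"
    and "\<And>j. 1 \<le> j \<Longrightarrow> distr M \<mu> (X j) = prob_of \<mu> h\<psi>"
    and "H4 \<Theta> \<mu> h h\<psi> \<theta>s"
    and "I3 \<mu> h h\<psi> \<theta>s"
  defines "\<xi>s \<equiv> (\<theta>s, ln (normalizer \<mu> h\<psi> / normalizer \<mu> (h \<theta>s)))"
  shows "loewner_le (V_NCE \<mu> h h\<psi> \<tau> \<xi>s) (V_IS \<mu> h h\<psi> \<tau> \<xi>s)"
proof -
  let ?P = "prob_of \<mu> (h \<theta>s)" and ?Q = "prob_of \<mu> h\<psi>"
  let ?Z = "normalizer \<mu> (h \<theta>s)" and ?Z\<psi> = "normalizer \<mu> h\<psi>"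
  define r where "r = lik_ratio \<mu> h h\<psi> \<xi>s"
  have ud: "unnormalized_density \<mu> (h \<theta>s)" and ud\<psi>: "unnormalized_density \<mu> h\<psi>"
    and ac: "absolutely_continuous ?Q ?P"
    using assms by auto
  have [measurable]: "h \<theta>s \<in> borel_measurable \<mu>" "h\<psi> \<in> borel_measurable \<mu>"
    and Z: "0 < ?Z" "0 < ?Z\<psi>"
    and nn: "\<And>x. x \<in> space \<mu> \<Longrightarrow> 0 \<le> h \<theta>s x" "\<And>x. x \<in> space \<mu> \<Longrightarrow> 0 \<le> h\<psi> x"
    using ud ud\<psi> by (auto simp: unnormalized_density_def)
  have sets [measurable_cong]: "sets ?P = sets \<mu>" "sets ?Q = sets \<mu>"
    and spaces: "space ?P = space \<mu>" "space ?Q = space \<mu>"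
    by (simp_all add: prob_of_def)
  interpret P: prob_space ?P by (rule prob_space_prob_of[OF ud])
  interpret Q: prob_space ?Q by (rule prob_space_prob_of[OF ud\<psi>])
  have Q_to_P: "AE x in ?P. R x" if "AE x in ?Q. R x" for R
    by (rule absolutely_continuous_AE[OF _ ac that]) (simp add: sets)

  obtain s where s_meas [measurable]: "s \<in> borel_measurable \<mu>"
    and s: "\<And>x D. GDERIV (\<lambda>t. h t x) \<theta>s :> D \<Longrightarrow> 0 < h \<theta>s x \<Longrightarrow> s x = grad_log h \<theta>s x"
    using borel_measurable_version_of_score[of \<Theta> \<theta>s h \<mu>] assms(1,3,7)
    by (metis unnormalized_density_def)
  define g where "g x = flatten (s x, 1)" for x
  have g_meas [measurable]: "g \<in> borel_measurable \<mu>" unfolding g_def by measurable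
  have norm_g: "(norm (g x))\<^sup>2 = 1 + (norm (s x))\<^sup>2" for x
    by (simp add: g_def norm_flatten_sq)

  have diff: "AE x in ?Q. \<exists>D. GDERIV (\<lambda>t. h t x) \<theta>s :> D"
  proof -
    have "AE x in ?Q. \<exists>U. open U \<and> \<theta>s \<in> U \<and> U \<subseteq> \<Theta> \<and> twice_cont_diff_on (\<lambda>\<theta>. h \<theta> x) U"
      using assms(12) by (simp add: H4_def)
    then show ?thesis by eventually_elim (auto simp: twice_cont_diff_on_def)
  qed
  \<comment> \<open>Where \<open>h \<theta>s\<close> vanishes, \<open>ln (h \<theta> x)\<close> need not be differentiable and its gradient may be arbitrary.
    That set is null for \<open>?P\<close>; under \<open>?Q\<close> it may have positive mass, but every integrand taken
    under \<open>?Q\<close> carries a factor that vanishes there.\<close>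
  have score: "AE x in ?Q. 0 < h \<theta>s x \<longrightarrow> grad_log h \<theta>s x = s x \<and> grad_ext h \<xi>s x = g x"
    using diff by eventually_elim (auto simp: \<xi>s_def g_def s grad_ext_eq_flatten)
  have h_pos: "AE x in ?P. 0 < h \<theta>s x" by (simp add: AE_prob_of_iff[OF ud])
  have h\<psi>_pos: "AE x in ?Q. 0 < h\<psi> x" by (simp add: AE_prob_of_iff[OF ud\<psi>])
  have score_P: "AE x in ?P. grad_log h \<theta>s x = s x \<and> grad_ext h \<xi>s x = g x"
    using Q_to_P[OF score] h_pos by eventually_elim auto

  have r: "r x = norm_density \<mu> (h \<theta>s) x / norm_density \<mu> h\<psi> x" for x
    by (simp add: r_def lik_ratio_def \<xi>s_def)
  have r_alt: "r x = (?Z\<psi> / ?Z) * (h \<theta>s x / h\<psi> x)" for x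
    by (simp add: r norm_density_def)
  have r_meas [measurable]: "r \<in> borel_measurable \<mu>" unfolding r_alt[abs_def] by measurable
  have r_nn: "0 \<le> r x" if "x \<in> space \<mu>" for x
    using nn[OF that] Z by (simp add: r_alt)
  have P_eq: "?P = density ?Q (\<lambda>x. ennreal (r x))"
    unfolding r by (rule prob_of_eq_density[OF ud ud\<psi> ac])
  have ratio: "nce_ratio \<mu> h h\<psi> \<tau> \<xi>s x = 1 / (1 + r x / \<tau>)" if "0 < h\<psi> x" for x
    using that Z assms(8) by (simp add: nce_ratio_def r norm_density_def \<xi>s_def divide_simps) (simp add: ac_simps)

  have int_H4: "integrable ?P (\<lambda>x. (norm (g x))\<^sup>2)"
  proof -
    obtain \<epsilon> where \<epsilon>: "0 < \<epsilon>"
      and fin: "(\<integral>\<^sup>+x. c_bound h \<theta>s \<epsilon> x * (SUP \<theta>\<in>ball \<theta>s \<epsilon>. ennreal (h \<theta> x)) \<partial>\<mu>) < \<infinity>"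
      using assms(12) by (auto simp: H4_def)
    \<comment> \<open>The dominating function need not be measurable, in which case its \<open>nn_integral\<close> is a lower
      integral; monotonicity holds regardless, and the dominated function is measurable.\<close>
    have "AE x in \<mu>. ennreal (h \<theta>s x * (norm (g x))\<^sup>2)
        \<le> c_bound h \<theta>s \<epsilon> x * (SUP \<theta>\<in>ball \<theta>s \<epsilon>. ennreal (h \<theta> x))"
      using score_P[unfolded AE_prob_of_iff[OF ud]] AE_space
    proof eventually_elim
      case (elim x)
      show ?case
      proof (cases "h \<theta>s x = 0")
        case False
        then have "0 < h \<theta>s x" using nn(1)[OF elim(2)] by simp
        then have "s x = grad_log h \<theta>s x" using elim(1) by simp
        then have "ennreal ((norm (g x))\<^sup>2) = 1 + ennreal ((norm (grad_log h \<theta>s x))\<^sup>2)"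
          by (simp add: norm_g ennreal_plus flip: ennreal_1)
        also have "\<dots> \<le> c_bound h \<theta>s \<epsilon> x"
          unfolding c_bound_def using \<epsilon>
          by (intro add_increasing2 add_mono order_refl SUP_upper) auto
        finally have 1: "ennreal ((norm (g x))\<^sup>2) \<le> c_bound h \<theta>s \<epsilon> x" .
        have "ennreal (h \<theta>s x) \<le> (SUP \<theta>\<in>ball \<theta>s \<epsilon>. ennreal (h \<theta> x))"
          using \<epsilon> by (intro SUP_upper) auto
        from mult_mono[OF 1 this] show ?thesis
          using \<open>0 < h \<theta>s x\<close> by (simp add: ennreal_mult mult.commute)
      qed simp
    qed
    then have "(\<integral>\<^sup>+x. ennreal (h \<theta>s x * (norm (g x))\<^sup>2) \<partial>\<mu>) < \<infinity>"
      using fin by (rule order.strict_trans1[OF nn_integral_mono_AE])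
    then have "integrable \<mu> (\<lambda>x. h \<theta>s x * (norm (g x))\<^sup>2)"
      using nn by (intro integrableI_nonneg) (auto intro!: AE_I2)
    then have "integrable \<mu> (\<lambda>x. h \<theta>s x * (norm (g x))\<^sup>2 / ?Z)" by simp
    then show ?thesis
      unfolding prob_of_def norm_density_def using nn Z
      by (subst integrable_density) (auto intro!: AE_I2)
  qed
  have int_I3: "integrable ?P (\<lambda>x. r x * (norm (g x))\<^sup>2)"
  proof -
    have "(\<integral>\<^sup>+x. ennreal ((norm (g x))\<^sup>2 * (h \<theta>s x / h\<psi> x)\<^sup>2) \<partial>?Q) =
        (\<integral>\<^sup>+x. ennreal ((1 + (norm (grad_log h \<theta>s x))\<^sup>2) * (h \<theta>s x / h\<psi> x)\<^sup>2) \<partial>?Q)"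
    proof (rule nn_integral_cong_AE)
      show "AE x in ?Q. ennreal ((norm (g x))\<^sup>2 * (h \<theta>s x / h\<psi> x)\<^sup>2) =
          ennreal ((1 + (norm (grad_log h \<theta>s x))\<^sup>2) * (h \<theta>s x / h\<psi> x)\<^sup>2)"
        using score AE_space
      proof eventually_elim
        case (elim x)
        then have "h \<theta>s x = 0 \<or> 0 < h \<theta>s x" using nn(1)[of x] by (auto simp: spaces)
        with elim show ?case by (auto simp: norm_g)
      qed
    qed
    also have "\<dots> < \<infinity>" using assms(13) by (simp add: I3_def)
    finally have "integrable ?Q (\<lambda>x. (norm (g x))\<^sup>2 * (h \<theta>s x / h\<psi> x)\<^sup>2)"
      by (intro integrableI_nonneg) auto
    then have "integrable ?Q (\<lambda>x. (?Z\<psi> / ?Z)\<^sup>2 * ((norm (g x))\<^sup>2 * (h \<theta>s x / h\<psi> x)\<^sup>2))"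
      by (rule integrable_mult_right)
    also have "(\<lambda>x. (?Z\<psi> / ?Z)\<^sup>2 * ((norm (g x))\<^sup>2 * (h \<theta>s x / h\<psi> x)\<^sup>2)) =
        (\<lambda>x. r x *\<^sub>R (r x * (norm (g x))\<^sup>2))"
      by (simp add: fun_eq_iff r_alt power2_eq_square) (simp add: ac_simps)
    finally show ?thesis
      unfolding P_eq using r_nn
      by (subst integrable_density) (auto intro!: AE_I2 simp: spaces)
  qed

  interpret score_moments ?Q ?P r g "Inr 1" \<tau>
  proof
    show "integrable ?P (\<lambda>x. (1 + r x) * (norm (g x))\<^sup>2)"
      using int_H4 int_I3 by (simp add: distrib_right)
    show "v = 0" if v: "AE x in ?P. v \<bullet> g x = 0" for v
    proof -
      obtain u c where uc: "v = flatten (u, c)" by (rule flatten_surj)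
      \<comment> \<open>Splitting off the last coordinate, degeneracy says that the score is constant in the
        direction \<open>u\<close>, which the Fisher information forbids unless \<open>u = 0\<close>.\<close>
      have const: "AE x in ?P. u \<bullet> s x = - c"
        using v by eventually_elim (simp add: uc g_def inner_flatten)
      have "integrable ?P s"
      proof (rule Bochner_Integration.integrable_bound[OF int_H4])
        have "norm (s x) \<le> norm ((norm (g x))\<^sup>2)" for x
        proof -
          have "0 \<le> (norm (s x) - 1)\<^sup>2" by simp
          then have "2 * norm (s x) \<le> 1 + (norm (s x))\<^sup>2" by (simp add: power2_diff)
          with norm_ge_zero[of "s x"] have "norm (s x) \<le> 1 + (norm (s x))\<^sup>2" by linarith
          then show ?thesis by (simp add: norm_g)
        qed
        then show "AE x in ?P. norm (s x) \<le> norm ((norm (g x))\<^sup>2)" by simp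
      qed measurable
      moreover have "integrable ?P (\<lambda>x. outer (s x) (s x))"
        by (rule Bochner_Integration.integrable_bound[OF int_H4])
           (auto simp: norm_outer norm_g simp flip: power2_eq_square)
      ultimately have "fisher_info \<mu> h \<theta>s *v u = 0"
        unfolding fisher_info_def using score_P
        by (intro covar_mult_vec_eq_0[OF P.prob_space_axioms _ _ _ const]) (auto elim: eventually_mono)
      moreover have "invertible (fisher_info \<mu> h \<theta>s)"
        using assms(12) by (simp add: H4_def)
      ultimately have "u = 0"
        using matrix_left_invertible_ker[of "fisher_info \<mu> h \<theta>s"] invertible_left_inverse by blast
      with const have "c = 0" by simp
      with \<open>u = 0\<close> show "v = 0"
        by (simp add: uc flatten_def vec_eq_iff split: sum.split)
    qed
  qed (use r_nn P_eq assms(8) in \<open>auto simp: spaces g_def\<close>)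

  have R: "AE x in ?Q. nce_ratio \<mu> h h\<psi> \<tau> \<xi>s x = 1 / (1 + r x / \<tau>)"
    using h\<psi>_pos by eventually_elim (rule ratio)
  have r_score: "AE x in ?Q. r x *\<^sub>R grad_ext h \<xi>s x = r x *\<^sub>R g x"
    using score AE_space
  proof eventually_elim
    case (elim x)
    then have "h \<theta>s x = 0 \<or> 0 < h \<theta>s x" using nn(1)[of x] by (auto simp: spaces)
    with elim show ?case by (auto simp: r_alt)
  qed
  have N: "AE x in ?P. nce_ratio \<mu> h h\<psi> \<tau> \<xi>s x *\<^sub>R grad_ext h \<xi>s x = (1 / (1 + r x / \<tau>)) *\<^sub>R g x"
    using Q_to_P[OF R] score_P by eventually_elim simp
  have N': "AE x in ?Q. (lik_ratio \<mu> h h\<psi> \<xi>s x * nce_ratio \<mu> h h\<psi> \<tau> \<xi>s x) *\<^sub>R grad_ext h \<xi>s x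
      = (r x * (1 / (1 + r x / \<tau>))) *\<^sub>R g x"
    using R r_score
  proof eventually_elim
    case (elim x)
    then show ?case
      using arg_cong[OF elim(2), of "\<lambda>v. (1 / (1 + r x / \<tau>)) *\<^sub>R v"] by (simp add: r_def[symmetric])
  qed
  have I: "AE x in ?P. grad_ext h \<xi>s x = g x" using score_P by eventually_elim simp
  have I': "AE x in ?Q. lik_ratio \<mu> h h\<psi> \<xi>s x *\<^sub>R grad_ext h \<xi>s x = r x *\<^sub>R g x"
    using r_score by (simp add: r_def)
  have K: "J_NCE \<mu> h h\<psi> \<tau> \<xi>s = (\<integral>x. (1 / (1 + r x / \<tau>)) *\<^sub>R outer (g x) (g x) \<partial>?P)"
  proof -
    have "AE x in ?P. nce_ratio \<mu> h h\<psi> \<tau> \<xi>s x *\<^sub>R outer (grad_ext h \<xi>s x) (grad_ext h \<xi>s x)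
        = (1 / (1 + r x / \<tau>)) *\<^sub>R outer (g x) (g x)"
      using Q_to_P[OF R] I by eventually_elim simp
    then show ?thesis unfolding J_NCE_def by (simp add: \<xi>s_def expct_eq_integral)
  qed
  have J: "J_IS \<mu> h \<xi>s = (\<integral>x. outer (g x) (g x) \<partial>?P)"
  proof -
    have "AE x in ?P. outer (grad_ext h \<xi>s x) (grad_ext h \<xi>s x) = outer (g x) (g x)"
      using I by eventually_elim simp
    then show ?thesis unfolding J_IS_def by (simp add: \<xi>s_def expct_eq_integral)
  qed
  have [simp]: "fst \<xi>s = \<theta>s" by (simp add: \<xi>s_def)
  show ?thesis
    using sandwich_loewner_le[OF N N' I I']
    by (simp only: V_NCE_def V_IS_def K J Sigma_NCE_def Gamma_NCE_def Sigma_IS_def Gamma_IS_def \<open>fst \<xi>s = \<theta>s\<close>)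
qed

end
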